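(* Let $n \geq 1$ and $S=S_1 \times S_2 \times \cdots \times S_n$, where for every $i=1,2,\ldots,n$, $S_i$ is a finite antinegative commutative semiring (with $1\neq 0$) such that $Z(S_i)$ is closed under addition. Furthermore, assume that for every $i=1,2,\ldots,n$ the following condition holds: $|Z(S_i)| \geq 2$ or there exists $j \neq i$ (with $1\le j\le n$) such that $|S_j \setminus Z(S_j)| \geq 2$. Then $$\dim(\Gamma_1(S))=|Z(S)|-2^n+1.$$
   Context: A semiring is a set $S$ with binary operations $+$ and $\cdot$ such that $(S,+)$ is a commutative monoid with identity $0$, $(S,\cdot)$ is a monoid with identity $1$, multiplication distributes over addition on both sides, and $0\cdot x = x\cdot 0 = 0$ for all $x\in S$. It is commutative if $ab=ba$ for all $a,b\in S$, and antinegative if $a+b=0$ with $a,b\in S$ implies $a=b=0$. Direct products of semirings have componentwise operations. The set of zero-divisors of $S$ is $Z(S)=\{x \in S : \text{there exists } 0 \neq y \in S \text{ such that } xy=0 \text{ or } yx=0\}$ (so $0\in Z(S)$ when $S\neq\{0\}$). $\Gamma_1(S)$ is the simple undirected graph with vertex set $Z(S)$ in which distinct $x,y\in Z(S)$ are adjacent if and only if $x+y\in Z(S)$ (it is the subgraph, induced on $Z(S)$, of the total graph of $S$). For a finite connected graph $G$, $d(u,v)$ denotes the length of a shortest path between $u$ and $v$. For an ordered subset $W=\{w_1,\ldots,w_k\}$ of the vertex set, the representation of a vertex $v$ with respect to $W$ is the vector $(d(v,w_1),\ldots,d(v,w_k))$. $W$ is a resolving set for $G$ if distinct vertices of $G$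 have distinct representations with respect to $W$. The metric dimension $\dim(G)$ is the minimal cardinality of a resolving set for $G$. *)

theory Defs
  imports "HOL-Algebra.Chinese_Remainder" "Graph_Theory.Graph_Theory"
begin

(* Graph_Theory uses this symbol for joining walks *)
no_notation vwalk_join (infixr \<open>\<oplus>\<close> 65)

section \<open>Semirings\<close>

definition antinegative :: "('a, 'm) ring_scheme \<Rightarrow> bool" where
  "antinegative R \<longleftrightarrow>
     (\<forall>a\<in>carrier R. \<forall>b\<in>carrier R. a \<oplus>\<^bsub>R\<^esub> b = \<zero>\<^bsub>R\<^esub> \<longrightarrow> a = \<zero>\<^bsub>R\<^esub> \<and> b = \<zero>\<^bsub>R\<^esub>)"

definition zero_divisors :: "('a, 'm) ring_scheme \<Rightarrow> 'a set" where
  "zero_divisors R =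
     {x \<in> carrier R. \<exists>y\<in>carrier R. y \<noteq> \<zero>\<^bsub>R\<^esub> \<and> (x \<otimes>\<^bsub>R\<^esub> y = \<zero>\<^bsub>R\<^esub> \<or> y \<otimes>\<^bsub>R\<^esub> x = \<zero>\<^bsub>R\<^esub>)}"

text \<open>
  The library defines the direct product \<^const>\<open>RDirProd_list\<close> by transporting the structure of
  iterated binary products to lists; the following two facts record that its operations are
  the componentwise ones.
\<close>

lemma RDirProd_list_add_nth:
  assumes "x \<in> carrier (RDirProd_list Rs)" "y \<in> carrier (RDirProd_list Rs)" "i < length Rs"
  shows "(x \<oplus>\<^bsub>RDirProd_list Rs\<^esub> y) ! i = x ! i \<oplus>\<^bsub>Rs ! i\<^esub> y ! i"
  using assms
proof (induct Rs arbitrary: x y i)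
  case (Cons R Rs)
  let ?P = "RDirProd R (RDirProd_list Rs)"
  let ?f = "\<lambda>(a, as). a # as"
  have inv: "inv_into (carrier ?P) ?f (a # as) = (a, as)"
    if "a \<in> carrier R" "as \<in> carrier (RDirProd_list Rs)" for a as
    using inv_into_f_f[OF inj_on_RDirProd_carrier, of "(a, as)" R Rs] that
    by (simp add: RDirProd_carrier)
  from Cons.prems obtain a as b bs where xy: "x = a # as" "y = b # bs"
    and mem: "a \<in> carrier R" "b \<in> carrier R"
      "as \<in> carrier (RDirProd_list Rs)" "bs \<in> carrier (RDirProd_list Rs)"
    by (auto simp: RDirProd_list_carrier)
  have "x \<oplus>\<^bsub>RDirProd_list (R # Rs)\<^esub> y
      = ?f (inv_into (carrier ?P) ?f x \<oplus>\<^bsub>?P\<^esub> inv_into (carrier ?P) ?f y)"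
    by (simp add: RDirProd_list_def image_ring_def monoid.defs)
  also have "\<dots> = (a \<oplus>\<^bsub>R\<^esub> b) # (as \<oplus>\<^bsub>RDirProd_list Rs\<^esub> bs)"
    by (simp add: xy inv mem) (simp add: RDirProd_def DirProd_def monoid.defs)
  finally show ?case
    using Cons.hyps[OF mem(3,4)] Cons.prems(3) by (cases i) (auto simp: xy)
qed simp

lemma RDirProd_list_mult_nth:
  assumes "x \<in> carrier (RDirProd_list Rs)" "y \<in> carrier (RDirProd_list Rs)" "i < length Rs"
  shows "(x \<otimes>\<^bsub>RDirProd_list Rs\<^esub> y) ! i = x ! i \<otimes>\<^bsub>Rs ! i\<^esub> y ! i"
  using assms
proof (induct Rs arbitrary: x y i)
  case (Cons R Rs)
  let ?P = "RDirProd R (RDirProd_list Rs)"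
  let ?f = "\<lambda>(a, as). a # as"
  have inv: "inv_into (carrier ?P) ?f (a # as) = (a, as)"
    if "a \<in> carrier R" "as \<in> carrier (RDirProd_list Rs)" for a as
    using inv_into_f_f[OF inj_on_RDirProd_carrier, of "(a, as)" R Rs] that
    by (simp add: RDirProd_carrier)
  from Cons.prems obtain a as b bs where xy: "x = a # as" "y = b # bs"
    and mem: "a \<in> carrier R" "b \<in> carrier R"
      "as \<in> carrier (RDirProd_list Rs)" "bs \<in> carrier (RDirProd_list Rs)"
    by (auto simp: RDirProd_list_carrier)
  have "x \<otimes>\<^bsub>RDirProd_list (R # Rs)\<^esub> y
      = ?f (inv_into (carrier ?P) ?f x \<otimes>\<^bsub>?P\<^esub> inv_into (carrier ?P) ?f y)"
    by (simp add: RDirProd_list_def image_ring_def image_group_def monoid.defs)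
  also have "\<dots> = (a \<otimes>\<^bsub>R\<^esub> b) # (as \<otimes>\<^bsub>RDirProd_list Rs\<^esub> bs)"
    by (simp add: xy inv mem) (simp add: RDirProd_def DirProd_def monoid.defs)
  finally show ?case
    using Cons.hyps[OF mem(3,4)] Cons.prems(3) by (cases i) (auto simp: xy)
qed simp


section \<open>The graph on the zero-divisors\<close>

text \<open>
  Simple undirected graphs are represented as in \<^theory>\<open>Graph_Theory.Pair_Digraph\<close>, that is, as
  symmetric loop-free digraphs without parallel arcs (\<^locale>\<open>pair_graph\<close>).
\<close>

definition Gamma1 :: "('a, 'm) ring_scheme \<Rightarrow> 'a pair_pre_digraph" where
  "Gamma1 R = \<lparr> pverts = zero_divisors R,
     parcs = {(x, y). x \<in> zero_divisors R \<and> y \<in> zero_divisors R \<and> x \<noteq> y \<and>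
                      x \<oplus>\<^bsub>R\<^esub> y \<in> zero_divisors R} \<rparr>"

lemma pair_graph_Gamma1:
  assumes "semiring R" "finite (carrier R)"
  shows "pair_graph (Gamma1 R)"
proof -
  interpret semiring R by fact
  have fin: "finite (zero_divisors R)"
    using assms(2) by (simp add: zero_divisors_def)
  have "parcs (Gamma1 R) \<subseteq> zero_divisors R \<times> zero_divisors R"
    by (auto simp: Gamma1_def)
  with fin have "finite (parcs (Gamma1 R))"
    by (meson finite_SigmaI finite_subset)
  moreover have "symmetric (with_proj (Gamma1 R))"
    by (auto simp: symmetric_def sym_def Gamma1_def zero_divisors_def a_comm)
  ultimately show ?thesis
    using fin by unfold_locales (auto simp: Gamma1_def)
qed

lemma connected_Gamma1:
  assumes "semiring R" "\<one>\<^bsub>R\<^esub> \<noteq> \<zero>\<^bsub>R\<^esub>" "finite (carrier R)"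
  shows "connected (with_proj (Gamma1 R))"
proof -
  interpret semiring R by fact
  interpret G: pair_graph "Gamma1 R" using assms pair_graph_Gamma1 by blast
  have z: "\<zero>\<^bsub>R\<^esub> \<in> zero_divisors R"
    using assms(2) by (force simp: zero_divisors_def)
  have sub: "x \<in> carrier R" if "x \<in> zero_divisors R" for x
    using that by (simp add: zero_divisors_def)
  have to0: "x \<rightarrow>\<^sup>*\<^bsub>with_proj (Gamma1 R)\<^esub> \<zero>\<^bsub>R\<^esub>" and from0: "\<zero>\<^bsub>R\<^esub> \<rightarrow>\<^sup>*\<^bsub>with_proj (Gamma1 R)\<^esub> x"
    if "x \<in> zero_divisors R" for x
  proof -
    have "x = \<zero>\<^bsub>R\<^esub> \<or> (x, \<zero>\<^bsub>R\<^esub>) \<in> parcs (Gamma1 R) \<and> (\<zero>\<^bsub>R\<^esub>, x) \<in> parcs (Gamma1 R)"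
      using that z sub by (auto simp: Gamma1_def)
    moreover have "\<zero>\<^bsub>R\<^esub> \<rightarrow>\<^sup>*\<^bsub>with_proj (Gamma1 R)\<^esub> \<zero>\<^bsub>R\<^esub>"
      using z by (intro G.reachable_refl) (simp add: Gamma1_def)
    ultimately show "x \<rightarrow>\<^sup>*\<^bsub>with_proj (Gamma1 R)\<^esub> \<zero>\<^bsub>R\<^esub>" "\<zero>\<^bsub>R\<^esub> \<rightarrow>\<^sup>*\<^bsub>with_proj (Gamma1 R)\<^esub> x"
      by auto
  qed
  have "strongly_connected (with_proj (Gamma1 R))"
    unfolding strongly_connected_def
  proof (intro conjI ballI)
    show "verts (with_proj (Gamma1 R)) \<noteq> {}"
      using z by (auto simp: Gamma1_def)
  next
    fix u v
    assume "u \<in> verts (with_proj (Gamma1 R))" "v \<in> verts (with_proj (Gamma1 R))"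
    then have "u \<in> zero_divisors R" "v \<in> zero_divisors R"
      by (simp_all add: Gamma1_def)
    then show "u \<rightarrow>\<^sup>*\<^bsub>with_proj (Gamma1 R)\<^esub> v"
      using G.reachable_trans[OF to0 from0] by blast
  qed
  then show ?thesis
    by (auto simp: connected_def strongly_connected_def intro!: G.reachable_mk_symmetricI)
qed


section \<open>Metric dimension\<close>

text \<open>
  As usual, these notions are meant for finite connected graphs only; where there is no path
  from \<open>u\<close> to \<open>v\<close>, the value of \<open>gdist G u v\<close> is unspecified.
\<close>

definition gdist :: "'a pair_pre_digraph \<Rightarrow> 'a \<Rightarrow> 'a \<Rightarrow> nat" where
  "gdist G u v = (LEAST k. \<exists>p. pre_digraph.apath (with_proj G) u p v \<and> length p = k)"

definition representation :: "'a pair_pre_digraph \<Rightarrow> 'a list \<Rightarrow> 'a \<Rightarrow> nat list" where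
  "representation G ws v = map (gdist G v) ws"

definition resolving :: "'a pair_pre_digraph \<Rightarrow> 'a list \<Rightarrow> bool" where
  "resolving G ws \<longleftrightarrow>
     distinct ws \<and> set ws \<subseteq> pverts G \<and> inj_on (representation G ws) (pverts G)"

definition metric_dimension :: "'a pair_pre_digraph \<Rightarrow> nat" where
  "metric_dimension G = (LEAST k. \<exists>ws. resolving G ws \<and> card (set ws) = k)"

end

theory Submission
  imports Defs
begin

text \<open>
  Assign to an element \<open>x\<close> of the product the set \<open>T x\<close> of those \<open>i\<close> for which \<open>x ! i\<close> is a
  zero-divisor of \<open>Ss ! i\<close>. An element of the product is a zero-divisor exactly if one of its
  coordinates is (\<open>zero_divisors_RDirProd_list_iff\<close>), so the vertices are the \<open>x\<close> with
  \<open>T x \<noteq> {}\<close>, and lists of zeros and ones show that all \<open>2 ^ n - 1\<close> nonempty sets of indices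
  occur. In an antinegative semiring a sum that is a zero-divisor has only zero-divisors as summands
  (\<open>zero_divisor_summands\<close>); together with the closedness of zero-divisors under addition this
  makes distinct vertices \<open>x\<close>, \<open>y\<close> adjacent exactly if \<open>T x\<close> and \<open>T y\<close> meet. Hence
  \<open>Gamma1 S\<close> is the intersection graph of a family of sets with repetitions, and its metric
  dimension is found from this description alone, in the locale \<open>intersection_graph\<close>.

  All distances are at most 2, because the vertices whose set is full are adjacent to every other
  one; so the distance of two distinct vertices depends only on their sets. Vertices with the same
  set are therefore twins, and a resolving set omits at most one vertex of each of the
  \<open>2 ^ n - 1\<close> twin classes: this is the lower bound. For the upper bound, omit exactly one vertex
  of every class. Two omitted vertices have distinct sets, and if \<open>i\<close> belongs to just one of these
  then any retained vertex with set \<open>{i}\<close> is at distance 1 from one of them and 2 from the other.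
  Such a vertex exists as soon as the class of \<open>{i}\<close> has two elements. As the size of that
  class is \<open>|Z(S\<^sub>i)|\<close> times the product of the \<open>|S\<^sub>j - Z(S\<^sub>j)|\<close> over \<open>j \<noteq> i\<close>, the last hypothesis
  of the theorem says precisely this.
\<close>

section \<open>Metric dimension of intersection graphs\<close>

text \<open>
  Several vertices may carry the same set, which is why the sets are given by a labelling instead of
  being the vertices themselves. The condition \<open>singleton_twins\<close> leaves a vertex with label \<open>{i}\<close>
  after one vertex has been removed from each class of equal labels.
\<close>

locale intersection_graph =
  fixes G :: "'a pair_pre_digraph" and I :: "'b set" and label :: "'a \<Rightarrow> 'b set"
  assumes finite_verts: "finite (pverts G)"
    and finite_index: "finite I"
    and arc_iff: "(x, y) \<in> parcs G \<longleftrightarrow>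
      x \<in> pverts G \<and> y \<in> pverts G \<and> x \<noteq> y \<and> label x \<inter> label y \<noteq> {}"
    and labels: "label ` pverts G = Pow I - {{}}"
    and singleton_twins: "i \<in> I \<Longrightarrow>
      \<exists>x\<in>pverts G. \<exists>y\<in>pverts G. x \<noteq> y \<and> label x = {i} \<and> label y = {i}"
begin

lemma card_labels: "int (card (Pow I - {{}})) = 2 ^ card I - 1"
proof -
  have "card (Pow I - {{}}) = 2 ^ card I - 1"
    using finite_index by (simp add: card_Diff_singleton card_Pow)
  then show ?thesis by (simp add: of_nat_diff)
qed

lemma gdist_eq:
  assumes u: "u \<in> pverts G" and v: "v \<in> pverts G"
  shows "gdist G u v = (if u = v then 0 else if label u \<inter> label v \<noteq> {} then 1 else 2)"
proof -
  interpret G: pair_wf_digraph G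
    by unfold_locales (metis arc_iff prod.collapse)+
  have zero: "(\<exists>p. G.apath u p v \<and> length p = 0) \<longleftrightarrow> u = v"
    using u by (simp add: G.apath_Nil_iff)
  have one: "(\<exists>p. G.apath u p v \<and> length p = 1) \<longleftrightarrow> (u, v) \<in> parcs G"
  proof
    assume "\<exists>p. G.apath u p v \<and> length p = 1"
    then show "(u, v) \<in> parcs G"
      by (auto simp: length_Suc_conv G.apath_simps)
  next
    assume "(u, v) \<in> parcs G"
    then have "G.apath u [(u, v)] v"
      using v by (simp add: arc_iff G.apath_simps)
    then show "\<exists>p. G.apath u p v \<and> length p = 1"
      by force
  qed
  have two: "\<exists>p. G.apath u p v \<and> length p = 2" if "u \<noteq> v" "label u \<inter> label v = {}"
  proof -
    have uv: "label u \<in> Pow I - {{}}" "label v \<in> Pow I - {{}}"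
      using labels u v by blast+
    \<comment> \<open>A vertex labelled by all of \<open>I\<close> is adjacent to every other vertex.\<close>
    then have "I \<in> label ` pverts G"
      using labels by blast
    then obtain w where w: "w \<in> pverts G" "label w = I"
      by blast
    have "w \<noteq> u" "w \<noteq> v"
      using w uv that by auto
    then have "(u, w) \<in> parcs G" "(w, v) \<in> parcs G"
      using uv w u v by (auto simp: arc_iff)
    then have "G.apath u [(u, w), (w, v)] v"
      using that \<open>w \<noteq> u\<close> \<open>w \<noteq> v\<close> v by (auto simp: G.apath_simps)
    then show ?thesis by force
  qed
  consider "u = v" | "u \<noteq> v" "label u \<inter> label v \<noteq> {}" | "u \<noteq> v" "label u \<inter> label v = {}"
    by blast
  then show ?thesis
  proof cases
    case 1
    then have "gdist G u v = 0"
      unfolding gdist_def using zero by (intro Least_eq_0) simp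
    with 1 show ?thesis by simp
  next
    case 2
    then have "(u, v) \<in> parcs G"
      using u v by (simp add: arc_iff)
    then have "gdist G u v = 1"
      unfolding gdist_def
    proof (intro Least_equality)
      show "\<exists>p. G.apath u p v \<and> length p = 1"
        using one \<open>(u, v) \<in> parcs G\<close> by blast
    next
      fix k
      assume "\<exists>p. G.apath u p v \<and> length p = k"
      then show "1 \<le> k"
        using zero 2 by (cases k) auto
    qed
    with 2 show ?thesis by simp
  next
    case 3
    then have "(u, v) \<notin> parcs G"
      by (simp add: arc_iff)
    have "gdist G u v = 2"
      unfolding gdist_def
    proof (intro Least_equality two 3)
      fix k
      assume "\<exists>p. G.apath u p v \<and> length p = k"
      then have "k \<noteq> 0" "k \<noteq> 1"
        using zero one 3 \<open>(u, v) \<notin> parcs G\<close> by blast+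
      then show "2 \<le> k" by simp
    qed
    with 3 show ?thesis by simp
  qed
qed

lemma representation_eq_iff:
  "representation G ws x = representation G ws y \<longleftrightarrow> (\<forall>w\<in>set ws. gdist G x w = gdist G y w)"
  by (auto simp: representation_def)

text \<open>
  Outside a resolving set no two vertices share a label, since vertices with the same label have the
  same distance to every third vertex.
\<close>

lemma resolving_lower_bound:
  assumes "resolving G ws"
  shows "int (card (pverts G)) - 2 ^ card I + 1 \<le> int (card (set ws))"
proof -
  have ws: "set ws \<subseteq> pverts G" and inj: "inj_on (representation G ws) (pverts G)"
    using assms by (auto simp: resolving_def)
  have "inj_on label (pverts G - set ws)"
  proof (rule inj_onI)
    fix x y
    assume x: "x \<in> pverts G - set ws" and y: "y \<in> pverts G - set ws" and eq: "label x = label y"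
    have "gdist G x w = gdist G y w" if "w \<in> set ws" for w
      using that ws x y eq by (auto simp: gdist_eq subset_iff)
    then have "representation G ws x = representation G ws y"
      by (simp add: representation_eq_iff)
    then show "x = y"
      using inj x y by (auto dest: inj_onD)
  qed
  moreover have "label ` (pverts G - set ws) \<subseteq> Pow I - {{}}"
    using labels by blast
  ultimately have "card (pverts G - set ws) \<le> card (Pow I - {{}})"
    using finite_index by (intro card_inj_on_le) auto
  moreover have "int (card (pverts G - set ws)) = int (card (pverts G)) - int (card (set ws))"
    using ws finite_verts by (simp add: card_Diff_subset card_mono of_nat_diff)
  ultimately show ?thesis
    using card_labels by linarith
qed

text \<open>
  Removing a transversal \<open>R\<close> of the classes of equal labels leaves a resolving set: for two removed
  vertices there is an index \<open>i\<close> in exactly one of their labels, and a remaining vertex labelled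
  \<open>{i}\<close> tells them apart.
\<close>

lemma resolving_transversal_complement:
  obtains ws where "resolving G ws"
    and "int (card (set ws)) = int (card (pverts G)) - 2 ^ card I + 1"
proof -
  define r where "r = inv_into (pverts G) label"
  define R where "R = r ` (Pow I - {{}})"
  have r: "r A \<in> pverts G" "label (r A) = A" if "A \<in> Pow I - {{}}" for A
    using that labels inv_into_into[of A label "pverts G"] f_inv_into_f[of A label "pverts G"]
    by (simp_all add: r_def)
  have R: "R \<subseteq> pverts G"
    using r by (auto simp: R_def)
  have r_S: "r (label x) = x" if "x \<in> R" for x
    using that r(2) unfolding R_def by (metis imageE)
  have "card R = card (Pow I - {{}})"
    unfolding R_def using r(2) by (intro card_image inj_on_inverseI)
  then have card_W: "int (card (pverts G - R)) = int (card (pverts G)) - 2 ^ card I + 1"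
    using card_labels R finite_verts card_mono[OF finite_verts R] finite_subset[OF R finite_verts]
    by (simp add: card_Diff_subset of_nat_diff del: card_Diff_insert)
  obtain ws where ws: "set ws = pverts G - R" "distinct ws"
    using finite_distinct_list finite_verts by (metis finite_Diff)
  have separate: "\<exists>w\<in>set ws. gdist G x w \<noteq> gdist G y w"
    if x: "x \<in> R" and y: "y \<in> R" and i: "i \<in> label x" "i \<notin> label y" for x y i
  proof -
    have "i \<in> I"
      using labels R x i by blast
    \<comment> \<open>At most one of the two vertices labelled \<open>{i}\<close> lies in the transversal \<open>R\<close>.\<close>
    then obtain w where w: "w \<in> pverts G" "label w = {i}" "w \<notin> R"
      using singleton_twins r_S by metis
    then have "gdist G x w = 1" "gdist G y w = 2"
      using x y R i by (auto simp: gdist_eq subset_iff)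
    then show ?thesis
      using w ws(1) by force
  qed
  have "inj_on (representation G ws) (pverts G)"
  proof (rule inj_onI)
    fix x y
    assume x: "x \<in> pverts G" and y: "y \<in> pverts G"
      and "representation G ws x = representation G ws y"
    then have eq: "gdist G x w = gdist G y w" if "w \<in> set ws" for w
      using that by (simp add: representation_eq_iff)
    show "x = y"
    proof (cases "x \<in> R \<and> y \<in> R")
      case True
      then have "label x = label y"
        using separate[of x y] separate[of y x] eq by (metis subsetI subset_antisym)
      then show ?thesis
        using True r_S by metis
    next
      case False
      \<comment> \<open>A member of \<open>ws\<close> is the only vertex at distance 0 from itself.\<close>
      then have "x \<in> set ws \<or> y \<in> set ws"
        using x y ws(1) by blast
      then have "gdist G y x = gdist G x x \<or> gdist G x y = gdist G y y"
        using eq by metis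
      then show ?thesis
        using x y by (simp add: gdist_eq split: if_splits)
    qed
  qed
  then have "resolving G ws"
    using ws by (auto simp: resolving_def)
  then show thesis
    using that card_W ws by simp
qed

theorem metric_dimension_eq:
  "int (metric_dimension G) = int (card (pverts G)) - 2 ^ card I + 1"
proof -
  obtain ws where ws: "resolving G ws"
    and card_ws: "int (card (set ws)) = int (card (pverts G)) - 2 ^ card I + 1"
    by (rule resolving_transversal_complement)
  have "metric_dimension G = card (set ws)"
    unfolding metric_dimension_def
  proof (rule Least_equality)
    show "\<exists>ws'. resolving G ws' \<and> card (set ws') = card (set ws)"
      using ws by blast
  next
    fix k
    assume "\<exists>ws'. resolving G ws' \<and> card (set ws') = k"
    then show "card (set ws) \<le> k"
      using resolving_lower_bound card_ws by fastforce
  qed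
  then show ?thesis
    using card_ws by simp
qed

end


section \<open>Zero-divisors of semirings and of direct products\<close>

lemma zero_divisors_subset: "zero_divisors R \<subseteq> carrier R"
  by (auto simp: zero_divisors_def)

lemma (in semiring) zero_in_zero_divisors:
  assumes "\<one> \<noteq> \<zero>"
  shows "\<zero> \<in> zero_divisors R"
  using assms by (force simp: zero_divisors_def)

lemma (in semiring) one_notin_zero_divisors: "\<one> \<notin> zero_divisors R"
  by (auto simp: zero_divisors_def)

text \<open>
  Multiplying \<open>x \<oplus> y\<close> by an annihilator \<open>z\<close> turns it into a vanishing sum of \<open>x \<otimes> z\<close> and \<open>y \<otimes> z\<close>,
  so antinegativity makes \<open>z\<close> annihilate both summands.
\<close>

lemma (in semiring) zero_divisor_summands:
  assumes "antinegative R" and x: "x \<in> carrier R" and y: "y \<in> carrier R"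
    and "x \<oplus> y \<in> zero_divisors R"
  shows "x \<in> zero_divisors R \<and> y \<in> zero_divisors R"
proof -
  obtain z where z: "z \<in> carrier R" "z \<noteq> \<zero>"
    and "(x \<oplus> y) \<otimes> z = \<zero> \<or> z \<otimes> (x \<oplus> y) = \<zero>"
    using assms(4) by (auto simp: zero_divisors_def)
  then have "x \<otimes> z \<oplus> y \<otimes> z = \<zero> \<or> z \<otimes> x \<oplus> z \<otimes> y = \<zero>"
    using x y by (simp add: l_distr r_distr)
  then have "x \<otimes> z = \<zero> \<and> y \<otimes> z = \<zero> \<or> z \<otimes> x = \<zero> \<and> z \<otimes> y = \<zero>"
    using assms(1) x y z by (meson antinegative_def m_closed)
  then show ?thesis
    using x y z by (auto simp: zero_divisors_def)
qed

lemma RDirProd_list_carrier_iff: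
  "x \<in> carrier (RDirProd_list Rs) \<longleftrightarrow>
     length x = length Rs \<and> (\<forall>i<length Rs. x ! i \<in> carrier (Rs ! i))"
  using RDirProd_list_carrier_mem RDirProd_list_carrier_memI by metis

lemma RDirProd_list_zero_map: "\<zero>\<^bsub>RDirProd_list Rs\<^esub> = map (\<lambda>R. \<zero>\<^bsub>R\<^esub>) Rs"
  unfolding RDirProd_list_zero by (induct Rs) auto

lemma RDirProd_list_Cons_ops:
  assumes "a \<in> carrier R" "b \<in> carrier R"
    and "as \<in> carrier (RDirProd_list Rs)" "bs \<in> carrier (RDirProd_list Rs)"
  shows "(a # as) \<otimes>\<^bsub>RDirProd_list (R # Rs)\<^esub> (b # bs) =
      (a \<otimes>\<^bsub>R\<^esub> b) # (as \<otimes>\<^bsub>RDirProd_list Rs\<^esub> bs)"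
    and "(a # as) \<oplus>\<^bsub>RDirProd_list (R # Rs)\<^esub> (b # bs) =
      (a \<oplus>\<^bsub>R\<^esub> b) # (as \<oplus>\<^bsub>RDirProd_list Rs\<^esub> bs)"
proof -
  let ?P = "RDirProd R (RDirProd_list Rs)"
  have "(a, as) \<in> carrier ?P" "(b, bs) \<in> carrier ?P"
    using assms by (auto simp: RDirProd_carrier)
  from ring_hom_mult[OF RDirProd_list_hom1 this] ring_hom_add[OF RDirProd_list_hom1 this]
  show "(a # as) \<otimes>\<^bsub>RDirProd_list (R # Rs)\<^esub> (b # bs) =
      (a \<otimes>\<^bsub>R\<^esub> b) # (as \<otimes>\<^bsub>RDirProd_list Rs\<^esub> bs)"
    and "(a # as) \<oplus>\<^bsub>RDirProd_list (R # Rs)\<^esub> (b # bs) =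
      (a \<oplus>\<^bsub>R\<^esub> b) # (as \<oplus>\<^bsub>RDirProd_list Rs\<^esub> bs)"
    by (simp_all add: RDirProd_def DirProd_def monoid.defs)
qed

text \<open>
  The elements of the product are lists, so a sum or product is determined by its coordinates only
  once its length is known.
\<close>

lemma RDirProd_list_ops_length:
  assumes "x \<in> carrier (RDirProd_list Rs)" "y \<in> carrier (RDirProd_list Rs)"
  shows "length (x \<otimes>\<^bsub>RDirProd_list Rs\<^esub> y) = length Rs"
    and "length (x \<oplus>\<^bsub>RDirProd_list Rs\<^esub> y) = length Rs"
proof -
  have "length (x \<otimes>\<^bsub>RDirProd_list Rs\<^esub> y) = length Rs \<and>
      length (x \<oplus>\<^bsub>RDirProd_list Rs\<^esub> y) = length Rs"
    using assms
  proof (induct Rs arbitrary: x y)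
    case Nil
    then show ?case by (simp add: monoid.defs)
  next
    case (Cons R Rs)
    then show ?case
      by (auto simp: RDirProd_list_carrier RDirProd_list_Cons_ops)
  qed
  then show "length (x \<otimes>\<^bsub>RDirProd_list Rs\<^esub> y) = length Rs"
    and "length (x \<oplus>\<^bsub>RDirProd_list Rs\<^esub> y) = length Rs"
    by auto
qed

lemma RDirProd_list_add_closed:
  assumes sr: "\<And>i. i < length Rs \<Longrightarrow> semiring (Rs ! i)"
    and x: "x \<in> carrier (RDirProd_list Rs)" and y: "y \<in> carrier (RDirProd_list Rs)"
  shows "x \<oplus>\<^bsub>RDirProd_list Rs\<^esub> y \<in> carrier (RDirProd_list Rs)"
proof (rule RDirProd_list_carrier_memI)
  show "length (x \<oplus>\<^bsub>RDirProd_list Rs\<^esub> y) = length Rs"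
    using x y by (rule RDirProd_list_ops_length)
next
  fix i
  assume i: "i < length Rs"
  then interpret semiring "Rs ! i" by (rule sr)
  show "(x \<oplus>\<^bsub>RDirProd_list Rs\<^esub> y) ! i \<in> carrier (Rs ! i)"
    using x y i by (simp add: RDirProd_list_add_nth RDirProd_list_carrier_mem(2))
qed

lemma zero_divisors_RDirProd_list_iff:
  assumes sr: "\<And>i. i < length Rs \<Longrightarrow> semiring (Rs ! i)"
    and x: "x \<in> carrier (RDirProd_list Rs)"
  shows "x \<in> zero_divisors (RDirProd_list Rs) \<longleftrightarrow>
    (\<exists>i<length Rs. x ! i \<in> zero_divisors (Rs ! i))"
proof
  let ?P = "RDirProd_list Rs"
  assume "x \<in> zero_divisors ?P"
  then obtain y where y: "y \<in> carrier ?P" "y \<noteq> \<zero>\<^bsub>?P\<^esub>"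
    and xy: "x \<otimes>\<^bsub>?P\<^esub> y = \<zero>\<^bsub>?P\<^esub> \<or> y \<otimes>\<^bsub>?P\<^esub> x = \<zero>\<^bsub>?P\<^esub>"
    by (auto simp: zero_divisors_def)
  then obtain i where i: "i < length Rs" "y ! i \<noteq> \<zero>\<^bsub>Rs ! i\<^esub>"
    by (auto simp: RDirProd_list_zero_map RDirProd_list_carrier_iff list_eq_iff_nth_eq)
  have "x ! i \<otimes>\<^bsub>Rs ! i\<^esub> y ! i = \<zero>\<^bsub>Rs ! i\<^esub> \<or> y ! i \<otimes>\<^bsub>Rs ! i\<^esub> x ! i = \<zero>\<^bsub>Rs ! i\<^esub>"
    using xy i x y RDirProd_list_mult_nth[of x Rs y i] RDirProd_list_mult_nth[of y Rs x i]
    by (auto simp: RDirProd_list_zero_map)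
  then show "\<exists>i<length Rs. x ! i \<in> zero_divisors (Rs ! i)"
    using i x y by (auto simp: zero_divisors_def RDirProd_list_carrier_iff)
next
  let ?P = "RDirProd_list Rs"
  assume "\<exists>i<length Rs. x ! i \<in> zero_divisors (Rs ! i)"
  then obtain i z where i: "i < length Rs" and z: "z \<in> carrier (Rs ! i)" "z \<noteq> \<zero>\<^bsub>Rs ! i\<^esub>"
    and xz: "x ! i \<otimes>\<^bsub>Rs ! i\<^esub> z = \<zero>\<^bsub>Rs ! i\<^esub> \<or> z \<otimes>\<^bsub>Rs ! i\<^esub> x ! i = \<zero>\<^bsub>Rs ! i\<^esub>"
    by (auto simp: zero_divisors_def)
  \<comment> \<open>The annihilator of the coordinate \<open>x ! i\<close>, extended by zeros.\<close>
  define y where "y = (\<zero>\<^bsub>?P\<^esub>)[i := z]"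
  have y_nth: "y ! j = (if j = i then z else \<zero>\<^bsub>Rs ! j\<^esub>)" if "j < length Rs" for j
    using that by (simp add: y_def RDirProd_list_zero_map nth_list_update)
  have y: "y \<in> carrier ?P"
    unfolding RDirProd_list_carrier_iff
  proof (intro conjI allI impI)
    fix j assume "j < length Rs"
    then interpret semiring "Rs ! j" by (rule sr)
    show "y ! j \<in> carrier (Rs ! j)"
      using \<open>j < length Rs\<close> z by (auto simp: y_nth)
  qed (simp add: y_def RDirProd_list_zero_map)
  have "y \<noteq> \<zero>\<^bsub>?P\<^esub>"
    using i z y_nth[OF i] by (auto simp: RDirProd_list_zero_map)
  have prod_nth:
    "(x \<otimes>\<^bsub>?P\<^esub> y) ! j = (if j = i then x ! i \<otimes>\<^bsub>Rs ! i\<^esub> z else \<zero>\<^bsub>Rs ! j\<^esub>)"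
    "(y \<otimes>\<^bsub>?P\<^esub> x) ! j = (if j = i then z \<otimes>\<^bsub>Rs ! i\<^esub> x ! i else \<zero>\<^bsub>Rs ! j\<^esub>)"
    if j: "j < length Rs" for j
  proof -
    interpret semiring "Rs ! j" using j by (rule sr)
    have "x ! j \<in> carrier (Rs ! j)"
      using x j by (simp add: RDirProd_list_carrier_iff)
    then show
      "(x \<otimes>\<^bsub>?P\<^esub> y) ! j = (if j = i then x ! i \<otimes>\<^bsub>Rs ! i\<^esub> z else \<zero>\<^bsub>Rs ! j\<^esub>)"
      "(y \<otimes>\<^bsub>?P\<^esub> x) ! j = (if j = i then z \<otimes>\<^bsub>Rs ! i\<^esub> x ! i else \<zero>\<^bsub>Rs ! j\<^esub>)"
      using x y j by (auto simp: RDirProd_list_mult_nth y_nth)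
  qed
  have "length (x \<otimes>\<^bsub>?P\<^esub> y) = length Rs" "length (y \<otimes>\<^bsub>?P\<^esub> x) = length Rs"
    using x y by (simp_all add: RDirProd_list_ops_length)
  then have "x \<otimes>\<^bsub>?P\<^esub> y = \<zero>\<^bsub>?P\<^esub> \<or> y \<otimes>\<^bsub>?P\<^esub> x = \<zero>\<^bsub>?P\<^esub>"
    using xz prod_nth by (auto simp: list_eq_iff_nth_eq RDirProd_list_zero_map)
  then show "x \<in> zero_divisors ?P"
    using x y \<open>y \<noteq> \<zero>\<^bsub>?P\<^esub>\<close> by (auto simp: zero_divisors_def)
qed


section \<open>The zero-divisor graph of a product as an intersection graph\<close>

text \<open>
  A vertex with a prescribed label is obtained by putting zeros at the places in the label and
  non-zero-divisors elsewhere. To change it without changing a singleton label \<open>{i}\<close>,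
  either replace the zero by another zero-divisor, or replace a one by another non-zero-divisor.
\<close>

lemma intersection_graph_Gamma1_RDirProd_list:
  fixes Ss :: "('a, 'm) ring_scheme list"
  assumes sr: "\<And>i. i < length Ss \<Longrightarrow> semiring (Ss ! i)"
    and fin: "\<And>i. i < length Ss \<Longrightarrow> finite (carrier (Ss ! i))"
    and anti: "\<And>i. i < length Ss \<Longrightarrow> antinegative (Ss ! i)"
    and nontriv: "\<And>i. i < length Ss \<Longrightarrow> \<one>\<^bsub>Ss ! i\<^esub> \<noteq> \<zero>\<^bsub>Ss ! i\<^esub>"
    and add_closed: "\<And>i x y. i < length Ss \<Longrightarrow> x \<in> zero_divisors (Ss ! i) \<Longrightarrow>
      y \<in> zero_divisors (Ss ! i) \<Longrightarrow> x \<oplus>\<^bsub>Ss ! i\<^esub> y \<in> zero_divisors (Ss ! i)"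
    and large: "\<And>i. i < length Ss \<Longrightarrow> card (zero_divisors (Ss ! i)) \<ge> 2 \<or>
      (\<exists>j<length Ss. j \<noteq> i \<and> card (carrier (Ss ! j) - zero_divisors (Ss ! j)) \<ge> 2)"
  shows "intersection_graph (Gamma1 (RDirProd_list Ss)) {..<length Ss}
    (\<lambda>x. {i. i < length Ss \<and> x ! i \<in> zero_divisors (Ss ! i)})"
proof -
  define P where "P = RDirProd_list Ss"
  define T where "T x = {i. i < length Ss \<and> x ! i \<in> zero_divisors (Ss ! i)}" for x
  have zd: "x \<in> zero_divisors P \<longleftrightarrow> T x \<noteq> {}" if "x \<in> carrier P" for x
    using zero_divisors_RDirProd_list_iff[OF sr] that by (auto simp: P_def T_def)
  have zd_carrier: "zero_divisors P \<subseteq> carrier P"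
    by (rule zero_divisors_subset)
  have zero: "\<zero>\<^bsub>Ss ! i\<^esub> \<in> zero_divisors (Ss ! i)" and one: "\<one>\<^bsub>Ss ! i\<^esub> \<in> carrier (Ss ! i)"
    and one': "\<one>\<^bsub>Ss ! i\<^esub> \<notin> zero_divisors (Ss ! i)" if i: "i < length Ss" for i
  proof -
    interpret semiring "Ss ! i" using i by (rule sr)
    show "\<zero>\<^bsub>Ss ! i\<^esub> \<in> zero_divisors (Ss ! i)"
      using nontriv[OF i] by (rule zero_in_zero_divisors)
    show "\<one>\<^bsub>Ss ! i\<^esub> \<in> carrier (Ss ! i)" by simp
    show "\<one>\<^bsub>Ss ! i\<^esub> \<notin> zero_divisors (Ss ! i)" by (rule one_notin_zero_divisors)
  qed
  have T_add: "T (x \<oplus>\<^bsub>P\<^esub> y) = T x \<inter> T y" if xy: "x \<in> carrier P" "y \<in> carrier P" for x y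
  proof -
    have "(x \<oplus>\<^bsub>P\<^esub> y) ! i \<in> zero_divisors (Ss ! i) \<longleftrightarrow>
        x ! i \<in> zero_divisors (Ss ! i) \<and> y ! i \<in> zero_divisors (Ss ! i)"
      if i: "i < length Ss" for i
    proof -
      have "x ! i \<in> carrier (Ss ! i)" "y ! i \<in> carrier (Ss ! i)"
        using xy i by (simp_all add: P_def RDirProd_list_carrier_iff)
      moreover have "(x \<oplus>\<^bsub>P\<^esub> y) ! i = x ! i \<oplus>\<^bsub>Ss ! i\<^esub> y ! i"
        using xy i unfolding P_def by (rule RDirProd_list_add_nth)
      ultimately show ?thesis
        using semiring.zero_divisor_summands[OF sr[OF i] anti[OF i]] add_closed[OF i] by metis
    qed
    then show ?thesis by (auto simp: T_def)
  qed
  \<comment> \<open>If all \<open>z i\<close> are zero-divisors and no \<open>u i\<close> is, this is a vertex with label \<open>A\<close>.\<close>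
  define vertex where "vertex A z u = map (\<lambda>i. if i \<in> A then z i else u i) [0..<length Ss]"
    for A and z u :: "nat \<Rightarrow> 'a"
  have vertex: "vertex A z u \<in> zero_divisors P \<and> T (vertex A z u) = A"
    if "A \<subseteq> {..<length Ss}" "A \<noteq> {}"
      and z: "\<And>i. i < length Ss \<Longrightarrow> z i \<in> zero_divisors (Ss ! i)"
      and u: "\<And>i. i < length Ss \<Longrightarrow> u i \<in> carrier (Ss ! i) - zero_divisors (Ss ! i)"
    for A z u
  proof -
    have "z i \<in> carrier (Ss ! i)" "u i \<in> carrier (Ss ! i)" if "i < length Ss" for i
      using z[OF that] u[OF that] zero_divisors_subset[of "Ss ! i"] by auto
    then have "vertex A z u \<in> carrier P"
      by (simp add: P_def RDirProd_list_carrier_iff vertex_def)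
    moreover have "T (vertex A z u) = A"
      using \<open>A \<subseteq> {..<length Ss}\<close> z u by (auto simp: T_def vertex_def split: if_splits)
    ultimately show ?thesis
      using zd \<open>A \<noteq> {}\<close> by simp
  qed
  have verts: "pverts (Gamma1 P) = zero_divisors P"
    by (simp add: Gamma1_def)
  have fin_P: "finite (carrier P)"
  proof (rule finite_subset)
    let ?U = "\<Union>i<length Ss. carrier (Ss ! i)"
    show "carrier P \<subseteq> {xs. set xs \<subseteq> ?U \<and> length xs = length Ss}"
    proof
      fix x
      assume "x \<in> carrier P"
      then have "length x = length Ss" "\<And>i. i < length Ss \<Longrightarrow> x ! i \<in> carrier (Ss ! i)"
        by (simp_all add: P_def RDirProd_list_carrier_iff)
      then show "x \<in> {xs. set xs \<subseteq> ?U \<and> length xs = length Ss}"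
        by (auto simp: in_set_conv_nth intro!: bexI[OF _ lessThan_iff[THEN iffD2]])
    qed
    show "finite {xs. set xs \<subseteq> ?U \<and> length xs = length Ss}"
      using fin by (intro finite_lists_length_eq) auto
  qed
  have "intersection_graph (Gamma1 P) {..<length Ss} T"
  proof
    show "finite (pverts (Gamma1 P))"
      using finite_subset[OF zd_carrier fin_P] by (simp add: verts)
    show "finite {..<length Ss}" by simp
  next
    fix x y
    have "x \<oplus>\<^bsub>P\<^esub> y \<in> zero_divisors P \<longleftrightarrow> T x \<inter> T y \<noteq> {}"
      if "x \<in> zero_divisors P" "y \<in> zero_divisors P"
    proof -
      have "x \<in> carrier P" "y \<in> carrier P"
        using that zd_carrier by blast+
      then show ?thesis
        using zd[OF RDirProd_list_add_closed[OF sr, of x y, folded P_def]] T_add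
        by (simp add: P_def)
    qed
    then show "(x, y) \<in> parcs (Gamma1 P) \<longleftrightarrow>
        x \<in> pverts (Gamma1 P) \<and> y \<in> pverts (Gamma1 P) \<and> x \<noteq> y \<and> T x \<inter> T y \<noteq> {}"
      by (auto simp: Gamma1_def)
  next
    show "T ` pverts (Gamma1 P) = Pow {..<length Ss} - {{}}"
    proof
      show "T ` pverts (Gamma1 P) \<subseteq> Pow {..<length Ss} - {{}}"
        using zd zd_carrier by (auto simp: verts T_def)
      show "Pow {..<length Ss} - {{}} \<subseteq> T ` pverts (Gamma1 P)"
      proof
        fix A
        assume A: "A \<in> Pow {..<length Ss} - {{}}"
        let ?x = "vertex A (\<lambda>k. \<zero>\<^bsub>Ss ! k\<^esub>) (\<lambda>k. \<one>\<^bsub>Ss ! k\<^esub>)"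
        have "?x \<in> zero_divisors P \<and> T ?x = A"
          using A zero one one' by (intro vertex) auto
        then show "A \<in> T ` pverts (Gamma1 P)"
          by (intro image_eqI[of _ T ?x]) (simp_all add: verts)
      qed
    qed
  next
    fix i
    assume "i \<in> {..<length Ss}"
    then have i: "i < length Ss" by simp
    have other: "\<exists>b\<in>B. b \<noteq> a" if "card B \<ge> 2" for B and a :: 'a
    proof (rule ccontr)
      assume "\<not> (\<exists>b\<in>B. b \<noteq> a)"
      then have "B \<subseteq> {a}" by blast
      from card_mono[OF _ this] that show False by simp
    qed
    let ?x = "vertex {i} (\<lambda>k. \<zero>\<^bsub>Ss ! k\<^esub>) (\<lambda>k. \<one>\<^bsub>Ss ! k\<^esub>)"
    have x: "?x \<in> zero_divisors P \<and> T ?x = {i}"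
      using i zero one one' by (intro vertex) auto
    have "\<exists>y\<in>zero_divisors P. ?x \<noteq> y \<and> T y = {i}"
      using large[OF i]
    proof (elim disjE exE conjE)
      assume "card (zero_divisors (Ss ! i)) \<ge> 2"
      then obtain z where z: "z \<in> zero_divisors (Ss ! i)" "z \<noteq> \<zero>\<^bsub>Ss ! i\<^esub>"
        using other by blast
      let ?y = "vertex {i} ((\<lambda>k. \<zero>\<^bsub>Ss ! k\<^esub>)(i := z)) (\<lambda>k. \<one>\<^bsub>Ss ! k\<^esub>)"
      have "?y \<in> zero_divisors P \<and> T ?y = {i}"
        using i z zero one one' by (intro vertex) auto
      moreover have "?x ! i \<noteq> ?y ! i"
        using i z by (simp add: vertex_def)
      ultimately show ?thesis
        by (intro bexI[of _ ?y] conjI notI) simp_all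
    next
      fix j
      assume j: "j < length Ss" "j \<noteq> i" "card (carrier (Ss ! j) - zero_divisors (Ss ! j)) \<ge> 2"
      then obtain u where u: "u \<in> carrier (Ss ! j) - zero_divisors (Ss ! j)" "u \<noteq> \<one>\<^bsub>Ss ! j\<^esub>"
        using other by blast
      let ?y = "vertex {i} (\<lambda>k. \<zero>\<^bsub>Ss ! k\<^esub>) ((\<lambda>k. \<one>\<^bsub>Ss ! k\<^esub>)(j := u))"
      have "?y \<in> zero_divisors P \<and> T ?y = {i}"
        using i u zero one one' by (intro vertex) auto
      moreover have "?x ! j \<noteq> ?y ! j"
        using j u by (simp add: vertex_def)
      ultimately show ?thesis
        by (intro bexI[of _ ?y] conjI notI) simp_all
    qed
    then show "\<exists>x\<in>pverts (Gamma1 P). \<exists>y\<in>pverts (Gamma1 P).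
        x \<noteq> y \<and> T x = {i} \<and> T y = {i}"
      using x unfolding verts by blast
  qed
  then show ?thesis
    by (simp add: P_def T_def[abs_def])
qed

theorem theorem3p3:
  fixes n :: nat and Ss :: "('a, 'm) ring_scheme list"
  assumes "n \<ge> 1" and "length Ss = n"
    and "\<And>i. i < n \<Longrightarrow> semiring (Ss ! i)"
    and "\<And>i. i < n \<Longrightarrow> comm_monoid (Ss ! i)"
    and "\<And>i. i < n \<Longrightarrow> finite (carrier (Ss ! i))"
    and "\<And>i. i < n \<Longrightarrow> antinegative (Ss ! i)"
    and "\<And>i. i < n \<Longrightarrow> \<one>\<^bsub>Ss ! i\<^esub> \<noteq> \<zero>\<^bsub>Ss ! i\<^esub>"
    and "\<And>i x y. i < n \<Longrightarrow> x \<in> zero_divisors (Ss ! i) \<Longrightarrow> y \<in> zero_divisors (Ss ! i) \<Longrightarrow>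
           x \<oplus>\<^bsub>Ss ! i\<^esub> y \<in> zero_divisors (Ss ! i)"
    and "\<And>i. i < n \<Longrightarrow> card (zero_divisors (Ss ! i)) \<ge> 2 \<or>
           (\<exists>j<n. j \<noteq> i \<and> card (carrier (Ss ! j) - zero_divisors (Ss ! j)) \<ge> 2)"
  defines "S \<equiv> RDirProd_list Ss"
  shows "int (metric_dimension (Gamma1 S)) = int (card (zero_divisors S)) - 2 ^ n + 1"
proof -
  note hyps = assms(3-9)[folded assms(2)]
  interpret intersection_graph "Gamma1 S" "{..<length Ss}"
    "\<lambda>x. {i. i < length Ss \<and> x ! i \<in> zero_divisors (Ss ! i)}"
    unfolding S_def
    using intersection_graph_Gamma1_RDirProd_list[OF hyps(1,3-7)] .
  have "pverts (Gamma1 S) = zero_divisors S"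
    by (simp add: Gamma1_def)
  then show ?thesis
    using metric_dimension_eq unfolding assms(2) card_lessThan by (simp only:)
qed

end
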